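(* Let $(H,d)$ be a Hadamard space. A convex set $C\subseteq H$ is strongly closed (closed in the metric topology) if and only if it is weakly closed (closed with respect to the weak topology $\tau_w$).
   Context: A Hadamard space is a complete $\mathrm{CAT}(0)$ space. A set $C\subseteq H$ is convex (geodesically convex) if for all $x,y\in C$ the geodesic segment $[x,y]$ is contained in $C$. For $x\in H$, $\Gamma_x(H)$ is the set of all constant speed geodesics $\gamma:[0,1]\to H$ (i.e. $d(\gamma(s),\gamma(t))=|s-t|\,d(\gamma(0),\gamma(1))$ for all $s,t\in[0,1]$) with $\gamma(0)=x$. For a geodesic $\gamma$, $P_\gamma$ denotes the metric projection onto (the image of) $\gamma$. For $x\in H$, $\gamma_1,\dots,\gamma_n\in\Gamma_x(H)$, $\varepsilon>0$, let $U_x(\varepsilon;\gamma_1,\dots,\gamma_n):=\{y\in H: d(x,P_{\gamma_i}y)<\varepsilon,\ i=1,\dots,n\}$. Weak topology $\tau_w$: a set $U\subset H$ is weakly open if for every $x\in U$ there exist $\varepsilon>0$ and finitely many $\gamma_1,\dots,\gamma_n\in\Gamma_x(H)$ with $U_x(\varepsilon;\gamma_1,\dots,\gamma_n)\subseteq U$. The weakly open sets (together with $\emptyset$) form the topology $\tau_w$ on $H$. *)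

theory Defs
  imports "HOL-Analysis.Analysis"
begin

definition geodesic :: "(real \<Rightarrow> 'a::metric_space) \<Rightarrow> bool" where
  "geodesic \<gamma> \<longleftrightarrow>
     (\<forall>s\<in>{0..1}. \<forall>t\<in>{0..1}. dist (\<gamma> s) (\<gamma> t) = \<bar>s - t\<bar> * dist (\<gamma> 0) (\<gamma> 1))"

definition geodesics_from :: "'a::metric_space \<Rightarrow> (real \<Rightarrow> 'a) set" where
  "geodesics_from x = {\<gamma>. geodesic \<gamma> \<and> \<gamma> 0 = x}"

definition geodesic_between :: "(real \<Rightarrow> 'a::metric_space) \<Rightarrow> 'a \<Rightarrow> 'a \<Rightarrow> bool" where
  "geodesic_between \<gamma> x y \<longleftrightarrow> geodesic \<gamma> \<and> \<gamma> 0 = x \<and> \<gamma> 1 = y"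

text \<open>
  For a side \<open>\<gamma>\<close> of a geodesic triangle and the corresponding side from \<open>u\<close> to \<open>v\<close> of a
  comparison triangle in the Euclidean plane: all pairs of a point of \<open>\<gamma>\<close> and its
  comparison point.
\<close>
definition comparison_pairs ::
    "(real \<Rightarrow> 'a::metric_space) \<Rightarrow> real^2 \<Rightarrow> real^2 \<Rightarrow> ('a \<times> (real^2)) set" where
  "comparison_pairs \<gamma> u v = {(\<gamma> t, (1 - t) *\<^sub>R u + t *\<^sub>R v) | t. t \<in> {0..1}}"

text \<open>
  The CAT(0) inequality for the geodesic triangle with sides \<open>\<alpha>\<close> from \<open>p\<close> to \<open>q\<close>,
  \<open>\<beta>\<close> from \<open>q\<close> to \<open>r\<close> and \<open>\<gamma>\<close> from \<open>r\<close> to \<open>p\<close>, against the comparison triangle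
  with vertices \<open>p'\<close>, \<open>q'\<close>, \<open>r'\<close>.
\<close>
definition CAT0_inequality ::
    "(real \<Rightarrow> 'a::metric_space) \<Rightarrow> (real \<Rightarrow> 'a) \<Rightarrow> (real \<Rightarrow> 'a) \<Rightarrow>
     real^2 \<Rightarrow> real^2 \<Rightarrow> real^2 \<Rightarrow> bool" where
  "CAT0_inequality \<alpha> \<beta> \<gamma> p' q' r' \<longleftrightarrow>
     (let R = comparison_pairs \<alpha> p' q' \<union> comparison_pairs \<beta> q' r' \<union> comparison_pairs \<gamma> r' p'
      in \<forall>(x, x')\<in>R. \<forall>(y, y')\<in>R. dist x y \<le> dist x' y')"

class hadamard_space = complete_space +
  assumes geodesic_exists: "\<exists>\<gamma>. geodesic_between \<gamma> x y"
    and CAT0: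
      "\<lbrakk>geodesic_between \<alpha> p q; geodesic_between \<beta> q r; geodesic_between \<gamma> r p;
        dist p' q' = dist p q; dist q' r' = dist q r; dist r' p' = dist r p\<rbrakk>
       \<Longrightarrow> CAT0_inequality \<alpha> \<beta> \<gamma> p' q' r'"

definition geodesically_convex :: "'a::metric_space set \<Rightarrow> bool" where
  "geodesically_convex C \<longleftrightarrow>
     (\<forall>x\<in>C. \<forall>y\<in>C. \<forall>\<gamma>. geodesic_between \<gamma> x y \<longrightarrow> \<gamma> ` {0..1} \<subseteq> C)"

text \<open>
  In a Hadamard space the nearest point on a geodesic exists and is unique, so the
  description below is proper.
\<close>
definition geodesic_proj :: "(real \<Rightarrow> 'a::metric_space) \<Rightarrow> 'a \<Rightarrow> 'a" where
  "geodesic_proj \<gamma> y =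
     (THE p. p \<in> \<gamma> ` {0..1} \<and> (\<forall>q\<in>\<gamma> ` {0..1}. dist y p \<le> dist y q))"

definition weak_nbhd :: "'a::metric_space \<Rightarrow> real \<Rightarrow> (real \<Rightarrow> 'a) set \<Rightarrow> 'a set" where
  "weak_nbhd x \<epsilon> G = {y. \<forall>\<gamma>\<in>G. dist x (geodesic_proj \<gamma> y) < \<epsilon>}"

definition weakly_open :: "'a::metric_space set \<Rightarrow> bool" where
  "weakly_open U \<longleftrightarrow>
     (\<forall>x\<in>U. \<exists>\<epsilon>>0. \<exists>G. finite G \<and> G \<subseteq> geodesics_from x \<and> weak_nbhd x \<epsilon> G \<subseteq> U)"

definition weak_topology :: "'a::metric_space topology" where
  "weak_topology = topology weakly_open"

lemma istopology_weakly_open: "istopology weakly_open"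
  unfolding istopology_def
proof (intro conjI allI impI)
  fix S T :: "'a set"
  assume S: "weakly_open S" and T: "weakly_open T"
  show "weakly_open (S \<inter> T)"
    unfolding weakly_open_def
  proof
    fix x assume x: "x \<in> S \<inter> T"
    obtain e G where 1: "e > 0" "finite G" "G \<subseteq> geodesics_from x" "weak_nbhd x e G \<subseteq> S"
      using S x unfolding weakly_open_def by blast
    obtain e' G' where 2: "e' > 0" "finite G'" "G' \<subseteq> geodesics_from x" "weak_nbhd x e' G' \<subseteq> T"
      using T x unfolding weakly_open_def by blast
    have "weak_nbhd x (min e e') (G \<union> G') \<subseteq> weak_nbhd x e G \<inter> weak_nbhd x e' G'"
      unfolding weak_nbhd_def by auto
    then have "weak_nbhd x (min e e') (G \<union> G') \<subseteq> S \<inter> T"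
      using 1(4) 2(4) by blast
    moreover have "min e e' > 0" "finite (G \<union> G')" "G \<union> G' \<subseteq> geodesics_from x"
      using 1 2 by auto
    ultimately show "\<exists>\<epsilon>>0. \<exists>G. finite G \<and> G \<subseteq> geodesics_from x \<and> weak_nbhd x \<epsilon> G \<subseteq> S \<inter> T"
      by blast
  qed
next
  fix K :: "'a set set"
  assume K: "\<forall>S\<in>K. weakly_open S"
  show "weakly_open (\<Union>K)"
    unfolding weakly_open_def
  proof
    fix x assume "x \<in> \<Union>K"
    then obtain S where S: "S \<in> K" "x \<in> S" by blast
    then obtain e G where "e > 0" "finite G" "G \<subseteq> geodesics_from x" "weak_nbhd x e G \<subseteq> S"
      using K unfolding weakly_open_def by blast
    moreover from this S have "weak_nbhd x e G \<subseteq> \<Union>K" by blast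
    ultimately show "\<exists>\<epsilon>>0. \<exists>G. finite G \<and> G \<subseteq> geodesics_from x \<and> weak_nbhd x \<epsilon> G \<subseteq> \<Union>K"
      by blast
  qed
qed

lemma openin_weak_topology: "openin weak_topology U \<longleftrightarrow> weakly_open U"
  by (simp add: weak_topology_def istopology_weakly_open topology_inverse')

lemma topspace_weak_topology: "topspace weak_topology = UNIV"
proof -
  have "weakly_open (UNIV :: 'a set)"
    unfolding weakly_open_def by (intro ballI exI[of _ 1] conjI exI[of _ "{}"]) auto
  then show ?thesis
    by (metis openin_weak_topology openin_subset top.extremum_uniqueI)
qed

end

theory Submission
  imports Defs
begin

text \<open>
  Both implications rest on one consequence of the \<open>CAT(0)\<close> inequality: along a geodesic the
  squared distance to a fixed point is bounded by its Euclidean value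
  (\<open>dist_geodesic_point_le\<close>).

  A weakly closed set is closed because every weak neighbourhood of \<open>x\<close> contains a ball
  around \<open>x\<close>: if \<open>\<gamma>\<close> starts at \<open>x\<close>, then \<open>x\<close> competes for being the nearest point of \<open>\<gamma>\<close>
  to \<open>y\<close>, so the projection of \<open>y\<close> lies within \<open>2 * dist x y\<close> of \<open>x\<close>.

  Conversely let \<open>C\<close> be closed and convex and \<open>x \<notin> C\<close>. Take the nearest point \<open>p\<close> of \<open>C\<close> to \<open>x\<close>
  and the geodesic \<open>\<gamma>\<close> from \<open>x\<close> to \<open>p\<close>. In a Hilbert space the hyperplane through \<open>p\<close>
  orthogonal to \<open>\<gamma>\<close> separates \<open>x\<close> from \<open>C\<close>; here the substitute for a half-space is the set of
  points that \<open>\<gamma>\<close> projects close to \<open>x\<close>. The point \<open>p\<close> is nearest in \<open>C\<close> to every point \<open>z\<close>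
  of \<open>\<gamma>\<close>, hence the triangle \<open>z, p, y\<close> with \<open>y \<in> C\<close> has no acute angle at \<open>p\<close>
  (\<open>not_acute_at_nearest_point\<close>). So \<open>y\<close> is strictly closer to \<open>p\<close> than to any other point of
  \<open>\<gamma>\<close>: the whole of \<open>C\<close> projects to \<open>p\<close>, and the weak neighbourhood of \<open>x\<close> of radius
  \<open>dist x p\<close> given by \<open>\<gamma>\<close> alone misses \<open>C\<close>.
\<close>

section \<open>Comparison triangles and the squared-distance inequality\<close>

text \<open>
  The first side is placed on the horizontal axis; the law of cosines then forces the
  abscissa \<open>u\<close> of the third vertex, and the triangle inequalities say exactly that
  \<open>\<bar>u\<bar> \<le> c\<close>, so that the ordinate is real.
\<close>
lemma comparison_triangle_exists:
  fixes a b c :: real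
  assumes "a \<ge> 0" "b \<ge> 0" "c \<ge> 0" "a \<le> b + c" "b \<le> a + c" "c \<le> a + b"
  obtains p q r :: "real^2" where "dist p q = a" "dist q r = b" "dist r p = c"
proof -
  have d: "dist (vector [x1, x2] :: real^2) (vector [y1, y2]) = sqrt ((x1 - y1)\<^sup>2 + (x2 - y2)\<^sup>2)"
    for x1 x2 y1 y2 :: real
    by (simp add: dist_vec_def L2_set_def sum_2 dist_real_def)
  show thesis
  proof (cases "a = 0")
    case True
    then have "b = c" using assms by simp
    show thesis
      by (rule that[of "vector [0, 0]" "vector [0, 0]" "vector [c, 0]"])
        (use True \<open>b = c\<close> assms in \<open>simp_all add: d\<close>)
  next
    case False
    then have a: "a > 0" using assms by simp
    define u where "u = (a\<^sup>2 + c\<^sup>2 - b\<^sup>2) / (2 * a)"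
    have u: "2 * a * u = a\<^sup>2 + c\<^sup>2 - b\<^sup>2" using a by (simp add: u_def)
    have "(a - c)\<^sup>2 \<le> b\<^sup>2" using assms by (intro abs_le_square_iff[THEN iffD1]) simp
    then have "2 * a * u \<le> 2 * a * c" unfolding u by (simp add: power2_diff)
    then have "u \<le> c" using a by simp
    have "b\<^sup>2 \<le> (a + c)\<^sup>2" using assms by (intro power_mono) simp_all
    then have "2 * a * (- c) \<le> 2 * a * u" unfolding u by (simp add: power2_sum)
    then have "- c \<le> u" using a by (simp only: mult_le_cancel_left_pos)
    with \<open>u \<le> c\<close> have "\<bar>u\<bar> \<le> \<bar>c\<bar>" by simp
    then have v: "u\<^sup>2 \<le> c\<^sup>2" by (simp only: abs_le_square_iff)
    have "(a - u)\<^sup>2 + (c\<^sup>2 - u\<^sup>2) = b\<^sup>2" using u by (simp add: power2_diff)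
    then show thesis
      using that[of "vector [0, 0]" "vector [a, 0]" "vector [u, sqrt (c\<^sup>2 - u\<^sup>2)]"] assms v
      by (simp add: d)
  qed
qed

lemma power2_dist_convex_combination:
  fixes u v w :: "'a::real_inner"
  shows "(dist ((1 - s) *\<^sub>R u + s *\<^sub>R v) w)\<^sup>2 =
    (1 - s) * (dist w u)\<^sup>2 + s * (dist w v)\<^sup>2 - s * (1 - s) * (dist u v)\<^sup>2"
  by (simp add: dist_norm power2_norm_eq_inner inner_simps inner_commute)
    (simp add: algebra_simps inner_commute)

lemma dist_geodesic_point_le:
  fixes z p q :: "'a::hadamard_space"
  assumes \<sigma>: "geodesic_between \<sigma> p q" and s: "s \<in> {0..1}"
  shows "(dist z (\<sigma> s))\<^sup>2 \<le>
    (1 - s) * (dist z p)\<^sup>2 + s * (dist z q)\<^sup>2 - s * (1 - s) * (dist p q)\<^sup>2"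
proof -
  obtain \<beta> \<gamma> where \<beta>: "geodesic_between \<beta> q z" and \<gamma>: "geodesic_between \<gamma> z p"
    using geodesic_exists by blast
  obtain p' q' z' :: "real^2"
    where t: "dist p' q' = dist p q" "dist q' z' = dist q z" "dist z' p' = dist z p"
    using comparison_triangle_exists[of "dist p q" "dist q z" "dist z p"]
    by (metis dist_commute dist_triangle zero_le_dist add.commute)
  let ?m = "(1 - s) *\<^sub>R p' + s *\<^sub>R q'"
  have "(\<sigma> s, ?m) \<in> comparison_pairs \<sigma> p' q'"
    using s by (auto simp: comparison_pairs_def)
  moreover have "(z, z') \<in> comparison_pairs \<gamma> z' p'"
    using \<gamma> by (auto simp: comparison_pairs_def geodesic_between_def intro!: exI[of _ 0])
  ultimately have "dist (\<sigma> s) z \<le> dist ?m z'"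
    using CAT0[OF \<sigma> \<beta> \<gamma> t] unfolding CAT0_inequality_def Let_def by blast
  then have "(dist z (\<sigma> s))\<^sup>2 \<le> (dist ?m z')\<^sup>2"
    by (simp add: dist_commute power_mono)
  also have "\<dots> = (1 - s) * (dist z p)\<^sup>2 + s * (dist z q)\<^sup>2 - s * (1 - s) * (dist p q)\<^sup>2"
    unfolding power2_dist_convex_combination using t by (simp add: dist_commute)
  finally show ?thesis .
qed

text \<open>
  Uniform convexity: two points that are nearly as close to \<open>z\<close> as their midpoint must be near
  each other. This yields uniqueness of nearest points (\<open>R = D\<close>) as well as the Cauchy property
  of minimizing sequences (\<open>R\<close> tending to \<open>D\<close>).
\<close>
lemma dist_near_minimizers_le:
  fixes z p q :: "'a::hadamard_space"
  assumes \<sigma>: "geodesic_between \<sigma> p q" and "0 \<le> D" "D \<le> dist z (\<sigma> (1/2))"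
    and "dist z p \<le> R" "dist z q \<le> R"
  shows "(dist p q)\<^sup>2 \<le> 4 * (R\<^sup>2 - D\<^sup>2)"
proof -
  have "D\<^sup>2 \<le> (dist z (\<sigma> (1/2)))\<^sup>2" "(dist z p)\<^sup>2 \<le> R\<^sup>2" "(dist z q)\<^sup>2 \<le> R\<^sup>2"
    using assms by (simp_all add: power_mono)
  with dist_geodesic_point_le[OF \<sigma>, of "1/2" z] show ?thesis by simp
qed

section \<open>Projection onto a geodesic\<close>

lemma geodesic_subsegment:
  assumes "geodesic \<gamma>" "s \<in> {0..1}" "t \<in> {0..1}"
  shows "geodesic_between (\<lambda>u. \<gamma> ((1 - u) * s + u * t)) (\<gamma> s) (\<gamma> t)"
proof -
  have mem: "(1 - u) * s + u * t \<in> {0..1}" if "u \<in> {0..1}" for u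
    using convexD_alt[OF convex_real_interval(5), of s 0 1 t u] that assms by simp
  have eq: "dist (\<gamma> a) (\<gamma> b) = \<bar>a - b\<bar> * dist (\<gamma> 0) (\<gamma> 1)" if "a \<in> {0..1}" "b \<in> {0..1}" for a b
    using assms(1) that unfolding geodesic_def by blast
  have seg: "dist (\<gamma> ((1 - u) * s + u * t)) (\<gamma> ((1 - v) * s + v * t)) =
      \<bar>u - v\<bar> * dist (\<gamma> s) (\<gamma> t)" if "u \<in> {0..1}" "v \<in> {0..1}" for u v
  proof -
    have "\<bar>((1 - u) * s + u * t) - ((1 - v) * s + v * t)\<bar> = \<bar>u - v\<bar> * \<bar>s - t\<bar>"
      unfolding abs_mult[symmetric] abs_eq_iff by (simp add: algebra_simps)
    then show ?thesis
      unfolding eq[OF mem[OF that(1)] mem[OF that(2)]] eq[OF assms(2,3)] by simp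
  qed
  then show ?thesis
    unfolding geodesic_between_def geodesic_def by simp
qed

lemma continuous_on_geodesic:
  assumes "geodesic \<gamma>"
  shows "continuous_on {0..1} \<gamma>"
proof -
  have "(dist (\<gamma> 0) (\<gamma> 1))-lipschitz_on {0..1} \<gamma>"
    by (intro lipschitz_onI)
      (use assms in \<open>simp_all only: geodesic_def dist_real_def mult.commute zero_le_dist order_refl\<close>)
  then show ?thesis by (rule lipschitz_on_continuous_on)
qed

lemma
  fixes y :: "'a::hadamard_space"
  assumes \<gamma>: "geodesic \<gamma>"
  shows geodesic_proj_in: "geodesic_proj \<gamma> y \<in> \<gamma> ` {0..1}"
    and geodesic_proj_nearest: "q \<in> \<gamma> ` {0..1} \<Longrightarrow> dist y (geodesic_proj \<gamma> y) \<le> dist y q"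
proof -
  let ?nearest = "\<lambda>p. p \<in> \<gamma> ` {0..1} \<and> (\<forall>q\<in>\<gamma> ` {0..1}. dist y p \<le> dist y q)"
  have "continuous_on {0..1} (\<lambda>t. dist y (\<gamma> t))"
    using continuous_on_geodesic[OF \<gamma>] by (intro continuous_intros)
  then have "\<exists>p. ?nearest p"
    using continuous_attains_inf[of "{0..1::real}" "\<lambda>t. dist y (\<gamma> t)"] by auto
  moreover have "p = q" if p: "?nearest p" and q: "?nearest q" for p q
  proof -
    obtain s t where st: "s \<in> {0..1}" "t \<in> {0..1}" "p = \<gamma> s" "q = \<gamma> t" using p q by auto
    have "(1 - 1/2) * s + 1/2 * t \<in> {0..1}" using st(1,2) by simp
    then have "dist y p \<le> dist y (\<gamma> ((1 - 1/2) * s + 1/2 * t))" using p by blast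
    moreover have "dist y q \<le> dist y p" using p q by blast
    ultimately have "(dist (\<gamma> s) (\<gamma> t))\<^sup>2 \<le> 4 * ((dist y p)\<^sup>2 - (dist y p)\<^sup>2)"
      using st by (intro dist_near_minimizers_le[OF geodesic_subsegment[OF \<gamma> st(1,2)]]) simp_all
    then show ?thesis using st by simp
  qed
  ultimately have "\<exists>!p. ?nearest p" by blast
  from theI'[OF this] have "?nearest (geodesic_proj \<gamma> y)"
    unfolding geodesic_proj_def .
  then show "geodesic_proj \<gamma> y \<in> \<gamma> ` {0..1}"
    and "q \<in> \<gamma> ` {0..1} \<Longrightarrow> dist y (geodesic_proj \<gamma> y) \<le> dist y q" by blast+
qed

section \<open>Nearest points of closed convex sets\<close>

text \<open>
  The points of \<open>C\<close> within \<open>1 / (n + 1)\<close> of the minimal distance form a nested sequence of closed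
  sets whose diameters tend to zero by uniform convexity; completeness gives a common point.
\<close>
lemma nearest_point_exists:
  fixes C :: "'a::hadamard_space set"
  assumes conv: "geodesically_convex C" and "closed C" "C \<noteq> {}"
  obtains p where "p \<in> C" "\<And>c. c \<in> C \<Longrightarrow> dist z p \<le> dist z c"
proof -
  define D where "D = infdist z C"
  define S where "S n = C \<inter> cball z (D + 1 / real (Suc n))" for n
  have D: "0 \<le> D" "\<And>c. c \<in> C \<Longrightarrow> D \<le> dist z c"
    by (simp_all add: D_def infdist_nonneg infdist_le)
  have lim: "(\<lambda>n. 1 / real (Suc n)) \<longlonglongrightarrow> 0"
    using LIMSEQ_inverse_real_of_nat by (simp only: inverse_eq_divide)
  obtain p where p: "\<And>n. p \<in> S n"
  proof (rule decreasing_closed_nest)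
    show "closed (S n)" for n using \<open>closed C\<close> by (simp add: S_def closed_Int)
    show "S n \<noteq> {}" for n
    proof -
      have "infdist z C < D + 1 / real (Suc n)" by (simp add: D_def)
      then obtain c where "c \<in> C" "dist z c < D + 1 / real (Suc n)"
        using \<open>C \<noteq> {}\<close> by (metis infdist_notempty cINF_less_iff bdd_below_image_dist)
      then show ?thesis unfolding S_def by (auto simp: less_imp_le)
    qed
    show "S n \<subseteq> S m" if "m \<le> n" for m n
    proof -
      have "1 / real (Suc n) \<le> 1 / real (Suc m)" using that by (simp add: frac_le)
      then show ?thesis unfolding S_def by auto
    qed
    show "\<exists>n. \<forall>p\<in>S n. \<forall>q\<in>S n. dist p q < e" if "e > 0" for e
    proof -
      have "(\<lambda>n. 4 * ((D + d n)\<^sup>2 - D\<^sup>2)) \<longlonglongrightarrow> 4 * ((D + 0)\<^sup>2 - D\<^sup>2)" if "d \<longlonglongrightarrow> 0" for d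
        by (intro tendsto_intros that)
      from this[OF lim] have "eventually (\<lambda>n. 4 * ((D + 1 / real (Suc n))\<^sup>2 - D\<^sup>2) < e\<^sup>2) sequentially"
        by (rule order_tendstoD(2)) (use \<open>e > 0\<close> in simp)
      then obtain n where n: "4 * ((D + 1 / real (Suc n))\<^sup>2 - D\<^sup>2) < e\<^sup>2"
        unfolding eventually_sequentially by blast
      have "dist p q < e" if "p \<in> S n" "q \<in> S n" for p q
      proof -
        have pq: "p \<in> C" "q \<in> C" using that by (auto simp: S_def)
        obtain \<sigma> where \<sigma>: "geodesic_between \<sigma> p q" using geodesic_exists by blast
        then have "\<sigma> ` {0..1} \<subseteq> C" using conv pq unfolding geodesically_convex_def by blast
        moreover have "1/2 \<in> {0..1::real}" by simp
        ultimately have "\<sigma> (1/2) \<in> C" by blast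
        then have "(dist p q)\<^sup>2 \<le> 4 * ((D + 1 / real (Suc n))\<^sup>2 - D\<^sup>2)"
          using that D by (intro dist_near_minimizers_le[OF \<sigma>]) (auto simp: S_def)
        also note n
        finally show ?thesis using \<open>e > 0\<close> by (simp add: power_less_imp_less_base)
      qed
      then show ?thesis by blast
    qed
  qed blast
  have "dist z p \<le> D"
  proof (rule LIMSEQ_le_const)
    show "(\<lambda>n. D + 1 / real (Suc n)) \<longlonglongrightarrow> D"
      using tendsto_add[OF tendsto_const[of D] lim] by simp
    show "\<exists>N. \<forall>n\<ge>N. dist z p \<le> D + 1 / real (Suc n)" using p by (auto simp: S_def)
  qed
  with D have "\<And>c. c \<in> C \<Longrightarrow> dist z p \<le> dist z c" by fastforce
  moreover have "p \<in> C" using p[of 0] by (simp add: S_def)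
  ultimately show thesis using that by blast
qed

text \<open>
  First variation: moving from \<open>p\<close> towards \<open>y\<close> by a fraction \<open>s\<close> changes the squared distance
  to \<open>z\<close> by at most \<open>s * ((dist z y)\<^sup>2 - (dist z p)\<^sup>2 - (dist p y)\<^sup>2)\<close> up to a term of second order
  in \<open>s\<close>. At a nearest point this change is nonnegative, so the first-order coefficient is too:
  the angle at \<open>p\<close> is not acute.
\<close>
lemma not_acute_at_nearest_point:
  fixes C :: "'a::hadamard_space set"
  assumes conv: "geodesically_convex C" and p: "p \<in> C" "\<And>c. c \<in> C \<Longrightarrow> dist z p \<le> dist z c"
    and y: "y \<in> C"
  shows "(dist z p)\<^sup>2 + (dist p y)\<^sup>2 \<le> (dist z y)\<^sup>2"
proof -
  obtain \<sigma> where \<sigma>: "geodesic_between \<sigma> p y" using geodesic_exists by blast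
  then have \<sigma>C: "\<sigma> ` {0..1} \<subseteq> C" using conv p(1) y unfolding geodesically_convex_def by blast
  have le: "(dist z p)\<^sup>2 + (1 - s) * (dist p y)\<^sup>2 \<le> (dist z y)\<^sup>2" if s: "0 < s" "s < 1" for s
  proof -
    have s01: "s \<in> {0..1}" using s by simp
    then have "\<sigma> s \<in> C" using \<sigma>C by blast
    then have "(dist z p)\<^sup>2 \<le> (dist z (\<sigma> s))\<^sup>2" using p(2) by (intro power_mono) simp_all
    also note dist_geodesic_point_le[OF \<sigma> s01]
    finally have "s * ((dist z p)\<^sup>2 + (1 - s) * (dist p y)\<^sup>2) \<le> s * (dist z y)\<^sup>2"
      by (simp add: algebra_simps)
    then show ?thesis using s by simp
  qed
  show ?thesis
  proof (rule tendsto_upperbound)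
    have "((\<lambda>s. (dist z p)\<^sup>2 + (1 - s) * (dist p y)\<^sup>2) \<longlongrightarrow>
        (dist z p)\<^sup>2 + (1 - 0) * (dist p y)\<^sup>2) (at_right (0::real))"
      by (intro tendsto_intros)
    then show "((\<lambda>s. (dist z p)\<^sup>2 + (1 - s) * (dist p y)\<^sup>2) \<longlongrightarrow>
        (dist z p)\<^sup>2 + (dist p y)\<^sup>2) (at_right (0::real))" by simp
    show "\<forall>\<^sub>F s in at_right 0. (dist z p)\<^sup>2 + (1 - s) * (dist p y)\<^sup>2 \<le> (dist z y)\<^sup>2"
      using eventually_at_right_less[of 0] eventually_at_right_real[of 0 1] le
      by (auto elim: eventually_mono)
  qed simp
qed

text \<open>
  Every point of the segment from \<open>x\<close> to its nearest point \<open>p\<close> also has \<open>p\<close> as nearest point in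
  \<open>C\<close>, because a shorter way from there to \<open>C\<close> would give a shorter way from \<open>x\<close>. Since the
  angle at \<open>p\<close> is not acute, \<open>p\<close> is the unique closest point of the segment for each \<open>y \<in> C\<close>.
\<close>
lemma geodesic_proj_to_nearest_point:
  fixes C :: "'a::hadamard_space set"
  assumes conv: "geodesically_convex C" and p: "p \<in> C" "\<And>c. c \<in> C \<Longrightarrow> dist x p \<le> dist x c"
    and \<gamma>: "geodesic_between \<gamma> x p" and y: "y \<in> C"
  shows "geodesic_proj \<gamma> y = p"
proof -
  have geo: "geodesic \<gamma>" and ends: "\<gamma> 0 = x" "\<gamma> 1 = p"
    using \<gamma> by (auto simp: geodesic_between_def)
  obtain t where t: "t \<in> {0..1}" and z: "geodesic_proj \<gamma> y = \<gamma> t"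
    using geodesic_proj_in[OF geo] by blast
  have eq: "dist (\<gamma> a) (\<gamma> b) = \<bar>a - b\<bar> * dist x p" if "a \<in> {0..1}" "b \<in> {0..1}" for a b
    using geo that ends unfolding geodesic_def by blast
  have xp: "dist x (\<gamma> t) + dist (\<gamma> t) p = dist x p"
    using eq[of 0 t] eq[of t 1] t ends by (simp add: algebra_simps)
  have "dist (\<gamma> t) p \<le> dist (\<gamma> t) c" if "c \<in> C" for c
    using p(2)[OF that] dist_triangle[of x c "\<gamma> t"] xp by simp
  from not_acute_at_nearest_point[OF conv p(1) this y]
  have "(dist (\<gamma> t) p)\<^sup>2 + (dist p y)\<^sup>2 \<le> (dist (\<gamma> t) y)\<^sup>2" .
  moreover have "p \<in> \<gamma> ` {0..1}" using ends by force
  then have "dist y (\<gamma> t) \<le> dist y p" using geodesic_proj_nearest[OF geo] z by metis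
  then have "(dist (\<gamma> t) y)\<^sup>2 \<le> (dist p y)\<^sup>2" by (simp add: dist_commute power_mono)
  ultimately have "(dist (\<gamma> t) p)\<^sup>2 \<le> 0" by linarith
  then show ?thesis using z by simp
qed

section \<open>Weak and strong topology\<close>

lemma weakly_open_imp_open:
  fixes U :: "'a::hadamard_space set"
  assumes "weakly_open U"
  shows "open U"
  unfolding open_contains_ball
proof
  fix x assume "x \<in> U"
  then obtain e G where e: "e > 0" and G: "G \<subseteq> geodesics_from x" and U: "weak_nbhd x e G \<subseteq> U"
    using assms unfolding weakly_open_def by blast
  have "ball x (e/2) \<subseteq> weak_nbhd x e G"
  proof
    fix y assume y: "y \<in> ball x (e/2)"
    have "dist x (geodesic_proj \<gamma> y) < e" if "\<gamma> \<in> G" for \<gamma>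
    proof -
      have \<gamma>: "geodesic \<gamma>" "\<gamma> 0 = x" using that G by (auto simp: geodesics_from_def)
      then have "x \<in> \<gamma> ` {0..1}" by force
      then have "dist y (geodesic_proj \<gamma> y) \<le> dist y x" by (rule geodesic_proj_nearest[OF \<gamma>(1)])
      with y dist_triangle[of x "geodesic_proj \<gamma> y" y] show ?thesis by (simp add: dist_commute)
    qed
    then show "y \<in> weak_nbhd x e G" by (simp add: weak_nbhd_def)
  qed
  then show "\<exists>e>0. ball x e \<subseteq> U" using U e by (meson half_gt_zero order_trans)
qed

lemma closed_convex_imp_weakly_open_Compl:
  fixes C :: "'a::hadamard_space set"
  assumes conv: "geodesically_convex C" and "closed C"
  shows "weakly_open (- C)"
  unfolding weakly_open_def
proof
  fix x assume x: "x \<in> - C"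
  show "\<exists>\<epsilon>>0. \<exists>G. finite G \<and> G \<subseteq> geodesics_from x \<and> weak_nbhd x \<epsilon> G \<subseteq> - C"
  proof (cases "C = {}")
    case True
    then show ?thesis by (intro exI[of _ 1] conjI exI[of _ "{}"]) auto
  next
    case False
    obtain p where p: "p \<in> C" "\<And>c. c \<in> C \<Longrightarrow> dist x p \<le> dist x c"
      using nearest_point_exists[OF conv \<open>closed C\<close> False] by blast
    obtain \<gamma> where \<gamma>: "geodesic_between \<gamma> x p" using geodesic_exists by blast
    have "weak_nbhd x (dist x p) {\<gamma>} \<subseteq> - C"
      using geodesic_proj_to_nearest_point[OF conv p \<gamma>] by (auto simp: weak_nbhd_def)
    moreover have "dist x p > 0" using x p(1) by auto
    moreover have "{\<gamma>} \<subseteq> geodesics_from x"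
      using \<gamma> by (simp add: geodesics_from_def geodesic_between_def)
    ultimately show ?thesis by blast
  qed
qed

theorem theorem2:
  fixes C :: "'a::hadamard_space set"
  assumes "geodesically_convex C"
  shows "closed C \<longleftrightarrow> closedin weak_topology C"
proof -
  have "closedin weak_topology C \<longleftrightarrow> weakly_open (- C)"
    by (simp add: closedin_def topspace_weak_topology openin_weak_topology Compl_eq_Diff_UNIV)
  then show ?thesis
    using closed_convex_imp_weakly_open_Compl[OF assms] weakly_open_imp_open[of "- C"]
    by (auto simp: closed_def)
qed

end
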